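(* For every $0<\epsilon<1$ there exist a constant $c=c(\epsilon)>0$ and an integer $n_0$ such that for all $n>n_0$ and all integers $1\le b\le (1-\epsilon)n/2$, Maker has a strategy in the $(1:b)$ Maker-Breaker game on the edges of the complete graph $K_n$ on $n$ vertices which guarantees that Maker's graph contains a cycle of length at least $cn$.
   Context: In the $(1:b)$ Maker-Breaker game on $E(K_n)$, where $b\ge 1$ is an integer (the game bias), two players, Maker and Breaker, alternately claim free (previously unclaimed) edges of $K_n$, with Maker moving first. In each turn Maker claims one edge, and Breaker claims $b$ edges (or all remaining edges, if fewer than $b$ remain). The game ends when all edges have been claimed. Maker's graph is the graph formed by the edges claimed by Maker at the end of the game. "Linearly long cycle" means a cycle of length at least $cn$, for a constant $c>0$ depending only on $\epsilon$. *)

theory Defs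
  imports Complex_Main "HOL-Library.Ramsey"
begin

(* A history is the list of completed rounds, in order of play: the element claimed by Maker,
   who moves first in each round, and the set of elements claimed by Breaker in reply. *)
type_synonym 'e history = "('e \<times> 'e set) list"

definition maker_claims :: "'e history \<Rightarrow> 'e set" where
  "maker_claims h = fst ` set h"

definition breaker_claims :: "'e history \<Rightarrow> 'e set" where
  "breaker_claims h = \<Union> (snd ` set h)"

definition free_elems :: "'e set \<Rightarrow> 'e history \<Rightarrow> 'e set" where
  "free_elems X h = X - (maker_claims h \<union> breaker_claims h)"

type_synonym 'e strategy = "'e history \<Rightarrow> 'e"

(* The histories of the (1:b) game on the board X in which Maker follows s and Breaker plays
   arbitrarily. The minimum makes Breaker take all remaining elements when fewer than b remain;
   in particular Breaker's reply is empty if Maker has just claimed the last free element. *)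
inductive consistent_play :: "'e set \<Rightarrow> nat \<Rightarrow> 'e strategy \<Rightarrow> 'e history \<Rightarrow> bool"
  for X :: "'e set" and b :: nat and s :: "'e strategy"
where
  start: "consistent_play X b s []"
| round: "\<lbrakk>consistent_play X b s h; s h \<in> free_elems X h;
    F \<subseteq> free_elems X h - {s h}; card F = min b (card (free_elems X h - {s h}))\<rbrakk>
    \<Longrightarrow> consistent_play X b s (h @ [(s h, F)])"

definition maker_strategy :: "'e set \<Rightarrow> nat \<Rightarrow> 'e strategy \<Rightarrow> bool" where
  "maker_strategy X b s \<longleftrightarrow>
    (\<forall>h. consistent_play X b s h \<longrightarrow> free_elems X h \<noteq> {} \<longrightarrow> s h \<in> free_elems X h)"

definition maker_guarantees :: "'e set \<Rightarrow> nat \<Rightarrow> 'e strategy \<Rightarrow> ('e set \<Rightarrow> bool) \<Rightarrow> bool" where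
  "maker_guarantees X b s P \<longleftrightarrow>
    (\<forall>h. consistent_play X b s h \<longrightarrow> free_elems X h = {} \<longrightarrow> P (maker_claims h))"

definition complete_graph_edges :: "nat \<Rightarrow> nat set set" where
  "complete_graph_edges n = [{..<n}]\<^bsup>2\<^esup>"

(* A cycle in the simple graph with edge set E, given by its vertices in cyclic order; the
   length of the list is the number of vertices, hence also of edges, of the cycle. *)
definition is_cycle :: "'v set set \<Rightarrow> 'v list \<Rightarrow> bool" where
  "is_cycle E vs \<longleftrightarrow> 3 \<le> length vs \<and> distinct vs \<and>
    (\<forall>i < length vs. {vs ! i, vs ! (Suc i mod length vs)} \<in> E)"

end

theory Submission
  imports Defs
begin

text \<open>
  Since \<open>b\<close> is at most \<open>(1 - \<epsilon>) n / 2\<close>, the first \<open>(1 + \<epsilon>/4) n\<close> rounds use up only part of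
  the board: in each of them Maker still chooses among a quadratic number of free edges.
  If he chose uniformly at random, then any fixed set of \<open>k\<close> edges would end up in his graph with
  probability \<open>O(1/n)\<^sup>k\<close>, whatever Breaker does. So, as in a sparse random graph, a first
  moment computation shows that for a small constant \<open>\<alpha>\<close> no nonempty set of \<open>u \<le> \<alpha> n\<close> vertices is
  likely to span \<open>(1 + 1/D) u\<close> of his edges, although he has at least \<open>(1 + 1/D)\<^sup>2 n\<close>
  edges in total. The randomness is removed by conditional expectations: Maker always takes an edge
  that minimises the potential bounding the expected number of bad edge sets.
  This is \<open>maker_avoids_family\<close>, and \<open>dense_spots_light\<close> is the first moment computation.

  A graph that is globally dense and locally sparse in this sense has a long cycle.
  In a minimal vertex set of edge density at least \<open>(1 + 1/D)\<^sup>2\<close>, every set \<open>W\<close> of vertices meets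
  at least \<open>(1 + 1/D)\<^sup>2 |W|\<close> edges. For small \<open>W\<close> these edges do not fit into a set of fewer than
  \<open>(1 + 1/D) |W|\<close> vertices, so \<open>W\<close> has at least \<open>|W| / D\<close> outside neighbours
  (\<open>expanding_subset_of_locally_sparse\<close>). Finally, if all sets of size between \<open>k/2\<close> and \<open>k\<close> have
  at least \<open>t\<close> outside neighbours, then some set of that size has all its neighbours on one path,
  which it closes to a cycle longer than \<open>t\<close> (\<open>cycle_of_expansion\<close>).
\<close>

section \<open>Long cycles from expansion\<close>

definition nbhd :: "'v set set \<Rightarrow> 'v set \<Rightarrow> 'v set \<Rightarrow> 'v set" where
  "nbhd E V W = {v \<in> V - W. \<exists>w\<in>W. {w, v} \<in> E}"

definition adj_on :: "'v set set \<Rightarrow> 'v set \<Rightarrow> ('v \<times> 'v) set" where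
  "adj_on E A = {(x, y). x \<in> A \<and> y \<in> A \<and> {x, y} \<in> E}"

lemma sym_adj_on: "sym (adj_on E A)"
  by (auto simp: sym_def adj_on_def insert_commute)

lemma adj_on_rtrancl_closed:
  assumes "(x, y) \<in> (adj_on E A)\<^sup>*" "x \<in> A" shows "y \<in> A"
  using assms by (induction) (auto simp: adj_on_def)

lemma is_cycleI:
  assumes "successively (\<lambda>a b. {a, b} \<in> E) vs" "{last vs, hd vs} \<in> E"
    "distinct vs" "3 \<le> length vs"
  shows "is_cycle E vs"
proof -
  have "{vs ! i, vs ! (Suc i mod length vs)} \<in> E" if i: "i < length vs" for i
  proof (cases "Suc i < length vs")
    case True
    then show ?thesis using assms(1) by (simp add: successively_conv_nth)
  next
    case False
    with i have "i = length vs - 1" "vs \<noteq> []" by auto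
    then show ?thesis using assms(2) by (simp add: last_conv_nth hd_conv_nth)
  qed
  then show ?thesis using assms by (simp add: is_cycle_def)
qed

lemma distinct_path_of_rtrancl:
  assumes "(x, y) \<in> (adj_on E A)\<^sup>*" "x \<in> A"
  shows "\<exists>p. p \<noteq> [] \<and> hd p = x \<and> last p = y \<and> distinct p \<and> set p \<subseteq> A \<and>
    successively (\<lambda>a b. {a, b} \<in> E) p"
  using assms
proof (induction rule: converse_rtrancl_induct)
  case base
  then show ?case by (intro exI[of _ "[y]"]) auto
next
  case (step x z)
  then have "x \<in> A" "z \<in> A" "{x, z} \<in> E" by (auto simp: adj_on_def)
  with step obtain p where p: "p \<noteq> []" "hd p = z" "last p = y" "distinct p" "set p \<subseteq> A"
    "successively (\<lambda>a b. {a, b} \<in> E) p" by blast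
  show ?case
  proof (cases "x \<in> set p")
    case True
    then obtain p1 p2 where "p = p1 @ x # p2" by (meson split_list)
    with p show ?thesis
      by (intro exI[of _ "x # p2"]) (auto simp: successively_append_iff split: if_splits)
  next
    case False
    with p \<open>x \<in> A\<close> \<open>{x, z} \<in> E\<close> show ?thesis
      by (intro exI[of _ "x # p"]) (auto simp: successively_Cons)
  qed
qed

text \<open>
  Cutting a walk at its last visit to \<open>x\<close>: after \<open>x\<close> is removed from its component \<open>C\<close>, every remaining
  vertex is still connected to some neighbour of \<open>x\<close>.
\<close>
lemma reach_avoiding_start:
  assumes "(x, y) \<in> (adj_on E A)\<^sup>*" "x \<in> A" and C: "C = {y. (x, y) \<in> (adj_on E A)\<^sup>*}"
  shows "y = x \<or> (\<exists>z\<in>C - {x}. {x, z} \<in> E \<and> (z, y) \<in> (adj_on E (C - {x}))\<^sup>*)"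
  using assms(1)
proof (induction rule: rtrancl_induct)
  case base
  then show ?case by simp
next
  case (step y y')
  have yC: "y \<in> C" "y' \<in> C" using step by (auto simp: C)
  have e: "{y, y'} \<in> E" using step by (auto simp: adj_on_def)
  show ?case
  proof (cases "y' = x \<or> y = x")
    case True
    then show ?thesis using yC e by blast
  next
    case False
    then have "(y, y') \<in> adj_on E (C - {x})" using yC e by (auto simp: adj_on_def)
    then show ?thesis using step.IH False by (meson rtrancl.rtrancl_into_rtrancl)
  qed
qed

text \<open>
  A largest union of components with at most \<open>k\<close> vertices works, unless it has fewer than \<open>k/2\<close>
  vertices. In that case any further component must itself have at least \<open>k/2\<close> vertices, since
  otherwise it could have been added.
\<close>
lemma union_of_components_of_medium_size:
  assumes "finite A" "k \<le> card A"
    and small: "\<And>x. x \<in> A \<Longrightarrow> card {y. (x, y) \<in> (adj_on E A)\<^sup>*} \<le> k"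
  obtains W where "W \<subseteq> A" "adj_on E A `` W \<subseteq> W" "k \<le> 2 * card W" "card W \<le> k"
proof -
  let ?closed = "\<lambda>W. W \<subseteq> A \<and> adj_on E A `` W \<subseteq> W"
  let ?P = "\<lambda>W. ?closed W \<and> card W \<le> k"
  have "?P {}" by auto
  moreover have "\<forall>W. ?P W \<longrightarrow> card W < Suc k" by auto
  ultimately obtain W where W: "?P W" and max: "\<And>W'. ?P W' \<Longrightarrow> card W' \<le> card W"
    using ex_has_greatest_nat[of ?P "{}" card "Suc k"] by blast
  show thesis
  proof (cases "k \<le> 2 * card W")
    case True
    then show thesis using that W by blast
  next
    case False
    then have "W \<noteq> A" using assms(2) by auto
    then obtain x where x: "x \<in> A" "x \<notin> W" using W by auto
    define C where "C = {y. (x, y) \<in> (adj_on E A)\<^sup>*}"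
    have "C \<subseteq> A" using adj_on_rtrancl_closed x by (fastforce simp: C_def)
    then have C: "?closed C" by (auto simp: C_def intro: rtrancl_into_rtrancl)
    have Ck: "card C \<le> k" using small x by (simp add: C_def)
    show thesis
    proof (cases "k \<le> 2 * card C")
      case True
      then show thesis using that C Ck by blast
    next
      case F2: False
      have "card (W \<union> C) \<le> card W + card C" by (rule card_Un_le)
      then have "?P (W \<union> C)" using W C F2 False by auto
      from max[OF this] have "card (W \<union> C) \<le> card W" .
      moreover have "card W < card (W \<union> C)"
        using x \<open>C \<subseteq> A\<close> W assms(1) by (intro psubset_card_mono)
          (auto simp: C_def intro: finite_subset)
      ultimately show thesis by simp
    qed
  qed
qed

text \<open>
  \<open>P\<close> is a path listed from its growing end, so \<open>hd P\<close> is the vertex next to which \<open>A\<close> lies. The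
  neighbour of \<open>W\<close> that comes last in \<open>P\<close> is preceded by all other neighbours; the initial segment of
  \<open>P\<close> up to it has at least \<open>t\<close> vertices and is closed to a cycle by a path through \<open>A\<close>.
\<close>
lemma close_cycle:
  assumes P: "distinct P" "successively (\<lambda>a b. {a, b} \<in> E) P" "set P \<inter> A = {}"
    and W: "W \<subseteq> A" and N: "nbhd E V W \<subseteq> set P" "t \<le> card (nbhd E V W)" "2 \<le> t"
    and reach: "\<And>y. y \<in> A \<Longrightarrow> P \<noteq> [] \<Longrightarrow>
      \<exists>z\<in>A. {hd P, z} \<in> E \<and> (z, y) \<in> (adj_on E A)\<^sup>*"
  shows "\<exists>vs. is_cycle E vs \<and> t < length vs"
proof -
  let ?N = "nbhd E V W"
  have "?N \<noteq> {}" using N by auto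
  then obtain v0 where "v0 \<in> ?N" by blast
  moreover from this N(1) obtain i0 where "i0 < length P" "P ! i0 = v0"
    by (auto simp: subset_iff in_set_conv_nth)
  ultimately have "i0 < length P \<and> P ! i0 \<in> ?N" by simp
  then obtain i where i: "i < length P" "P ! i \<in> ?N"
    and imax: "\<And>j. j < length P \<Longrightarrow> P ! j \<in> ?N \<Longrightarrow> j \<le> i"
    using ex_has_greatest_nat[of "\<lambda>i. i < length P \<and> P ! i \<in> ?N" i0 "\<lambda>i. i" "length P"]
    by blast
  define R where "R = take (Suc i) P"
  have "?N \<subseteq> set R"
  proof
    fix v assume v: "v \<in> ?N"
    with N(1) obtain j where j: "j < length P" "P ! j = v" by (auto simp: subset_iff in_set_conv_nth)
    then have "j < length R" "R ! j = v" using imax[of j] v i by (auto simp: R_def)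
    then show "v \<in> set R" by (metis nth_mem)
  qed
  then have "card ?N \<le> card (set R)" by (intro card_mono) auto
  also have "\<dots> \<le> length R" by (rule card_length)
  finally have tR: "t \<le> length R" using N by simp
  have Rne: "R \<noteq> []" "P \<noteq> []" using tR N(3) by (auto simp: R_def)
  have lastR: "last R = P ! i" using i by (simp add: R_def take_Suc_conv_app_nth)
  have hdR: "hd R = hd P" using Rne by (simp add: R_def)
  have sucR: "successively (\<lambda>a b. {a, b} \<in> E) R"
    using P(2) successively_append_iff[of _ R "drop (Suc i) P"] by (simp add: R_def)
  obtain w where w: "w \<in> W" "{w, P ! i} \<in> E" using i(2) by (auto simp: nbhd_def)
  then have "w \<in> A" using W by auto
  with reach Rne obtain z where z: "z \<in> A" "{hd P, z} \<in> E" "(z, w) \<in> (adj_on E A)\<^sup>*" by blast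
  have "(w, z) \<in> (adj_on E A)\<^sup>*" using z(3) sym_adj_on by (metis sym_rtrancl symD)
  from distinct_path_of_rtrancl[OF this \<open>w \<in> A\<close>] obtain q where
    q: "q \<noteq> []" "hd q = w" "last q = z" "distinct q" "set q \<subseteq> A"
    "successively (\<lambda>a b. {a, b} \<in> E) q" by blast
  have lq: "length q \<ge> 1" using q(1) by (cases q) auto
  have "is_cycle E (R @ q)"
  proof (rule is_cycleI)
    show "successively (\<lambda>a b. {a, b} \<in> E) (R @ q)"
      using sucR q w lastR by (auto simp: successively_append_iff insert_commute)
    show "{last (R @ q), hd (R @ q)} \<in> E" using Rne q z hdR by (simp add: insert_commute)
    show "distinct (R @ q)" using P q by (auto simp: R_def dest: in_set_takeD)
    show "3 \<le> length (R @ q)" using tR N(3) lq by simp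
  qed
  moreover have "t < length (R @ q)" using tR lq by simp
  ultimately show ?thesis by blast
qed

text \<open>
  Depth-first search without the search tree. The path \<open>P\<close> grows at its head and \<open>A\<close> is a set of
  at least \<open>k\<close> vertices whose outside neighbours all lie on \<open>P\<close>. If some component of \<open>A\<close> has more
  than \<open>k\<close> vertices, then \<open>P\<close> is extended into it by a neighbour \<open>x\<close> of its head (any vertex if \<open>P\<close> is
  empty), and \<open>A\<close> shrinks to the rest of that component.
  Otherwise a union of components has size between \<open>k/2\<close> and \<open>k\<close>, all its neighbours
  lie on \<open>P\<close>, and a cycle can be closed. The last hypothesis says that every component of \<open>A\<close> touches
  the head of \<open>P\<close>.
\<close>
lemma cycle_of_expansion_aux:
  fixes E :: "'v set set"
  assumes V: "finite V"
    and exp: "\<And>W. W \<subseteq> V \<Longrightarrow> k \<le> 2 * card W \<Longrightarrow> card W \<le> k \<Longrightarrow> t \<le> card (nbhd E V W)"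
    and t: "2 \<le> t"
    and "A \<subseteq> V" "k \<le> card A" "nbhd E V A \<subseteq> set P"
      "distinct P" "successively (\<lambda>a b. {a, b} \<in> E) P" "set P \<inter> A = {}"
      "\<And>y. y \<in> A \<Longrightarrow> P \<noteq> [] \<Longrightarrow> \<exists>z\<in>A. {hd P, z} \<in> E \<and> (z, y) \<in> (adj_on E A)\<^sup>*"
  shows "\<exists>vs. is_cycle E vs \<and> t < length vs"
  using assms(4-)
proof (induction "card A" arbitrary: A P rule: less_induct)
  case less
  note AV = less.prems(1) and kA = less.prems(2) and NA = less.prems(3)
  note P = less.prems(4-6) and reach = less.prems(7)
  have finA: "finite A" using AV V finite_subset by blast
  show ?case
  proof (cases "\<forall>x\<in>A. card {y. (x, y) \<in> (adj_on E A)\<^sup>*} \<le> k")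
    case True
    obtain W where W: "W \<subseteq> A" "adj_on E A `` W \<subseteq> W" "k \<le> 2 * card W" "card W \<le> k"
      by (rule union_of_components_of_medium_size[OF finA kA, of E]) (use True in auto)
    have "nbhd E V W \<subseteq> nbhd E V A"
      using W(1,2) by (auto simp: nbhd_def adj_on_def)
    then have "nbhd E V W \<subseteq> set P" using NA by simp
    moreover have "t \<le> card (nbhd E V W)" using exp W AV by blast
    ultimately show ?thesis using close_cycle[OF P W(1) _ _ t reach] by blast
  next
    case False
    then obtain x0 where x0: "x0 \<in> A" and big0: "k < card {y. (x0, y) \<in> (adj_on E A)\<^sup>*}"
      by force
    obtain x where x: "x \<in> A" "P \<noteq> [] \<Longrightarrow> {hd P, x} \<in> E"
        "(x, x0) \<in> (adj_on E A)\<^sup>*"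
      using reach[OF x0] x0 by (cases "P = []") auto
    define C where "C = {y. (x, y) \<in> (adj_on E A)\<^sup>*}"
    have "{y. (x0, y) \<in> (adj_on E A)\<^sup>*} \<subseteq> C"
      using x(3) by (auto simp: C_def)
    moreover have CA: "C \<subseteq> A" using adj_on_rtrancl_closed x by (fastforce simp: C_def)
    then have finC: "finite C" using finA finite_subset by blast
    ultimately have big: "k < card C" using big0 by (meson card_mono order_less_le_trans)
    have xC: "x \<in> C" by (simp add: C_def)
    have closed: "w \<in> C \<Longrightarrow> v \<in> A \<Longrightarrow> {w, v} \<in> E \<Longrightarrow> v \<in> C" for w v
      using CA by (auto simp: C_def adj_on_def intro!: rtrancl_into_rtrancl[of x w])
    show ?thesis
    proof (rule less.hyps[of "C - {x}" "x # P"])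
      show "card (C - {x}) < card A"
        using CA finA xC by (meson card_Diff1_less card_mono finC order_less_le_trans)
      show "C - {x} \<subseteq> V" using CA AV by auto
      show "k \<le> card (C - {x})" using big xC finC by simp
      show "nbhd E V (C - {x}) \<subseteq> set (x # P)"
      proof
        fix v assume "v \<in> nbhd E V (C - {x})"
        then obtain w where w: "v \<in> V" "v \<notin> C - {x}" "w \<in> C - {x}" "{w, v} \<in> E"
          by (auto simp: nbhd_def)
        show "v \<in> set (x # P)"
        proof (cases "v \<in> A")
          case True
          then show ?thesis using closed[of w v] w by auto
        next
          case False
          then have "v \<in> nbhd E V A" using w CA by (auto simp: nbhd_def)
          then show ?thesis using NA by auto
        qed
      qed
      show "distinct (x # P)" using P x by auto
      show "successively (\<lambda>a b. {a, b} \<in> E) (x # P)"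
        using P(2) x(2) by (auto simp: successively_Cons insert_commute)
      show "set (x # P) \<inter> (C - {x}) = {}" using P CA by auto
      fix y assume "y \<in> C - {x}"
      then show "\<exists>z\<in>C - {x}. {hd (x # P), z} \<in> E \<and> (z, y) \<in> (adj_on E (C - {x}))\<^sup>*"
        using reach_avoiding_start[of x y E A C] x(1) by (auto simp: C_def)
    qed
  qed
qed

lemma cycle_of_expansion:
  fixes E :: "'v set set"
  assumes "finite V" "k \<le> card V" "2 \<le> t"
    and "\<And>W. W \<subseteq> V \<Longrightarrow> k \<le> 2 * card W \<Longrightarrow> card W \<le> k \<Longrightarrow> t \<le> card (nbhd E V W)"
  shows "\<exists>vs. is_cycle E vs \<and> t < length vs"
  by (rule cycle_of_expansion_aux[of V k t E V "[]"]) (use assms in \<open>auto simp: nbhd_def\<close>)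

section \<open>Expansion from local sparsity\<close>

definition edges_within :: "'v set set \<Rightarrow> 'v set \<Rightarrow> 'v set set" where
  "edges_within E U = {e \<in> E. e \<subseteq> U}"

text \<open>
  Take a smallest nonempty \<open>V'\<close> with edge density at least \<open>(1 + 1/D)\<^sup>2\<close>. It is too dense to have at
  most \<open>m\<close> vertices. Deleting \<open>W\<close> from it leaves a set of at most that density, so at least
  \<open>(1 + 1/D)\<^sup>2 |W|\<close> edges of \<open>V'\<close> meet \<open>W\<close>. They all lie inside \<open>U\<close>, the union of \<open>W\<close> and its
  neighbourhood, and \<open>|U| < (1 + 1/D) |W|\<close> would make \<open>U\<close> a small set of density above \<open>1 + 1/D\<close>.
\<close>
lemma expanding_subset_of_locally_sparse:
  fixes E :: "'v set set" and D m :: nat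
  assumes V: "finite V" "V \<noteq> {}" and E: "E \<subseteq> [V]\<^bsup>2\<^esup>"
    and dense: "(D + 1)\<^sup>2 * card V \<le> D\<^sup>2 * card E"
    and sparse: "\<And>U. U \<subseteq> V \<Longrightarrow> U \<noteq> {} \<Longrightarrow> card U \<le> m \<Longrightarrow>
      D * card (edges_within E U) < (D + 1) * card U"
  obtains V' where "V' \<subseteq> V" "m < card V'"
    "\<And>W. W \<subseteq> V' \<Longrightarrow> 2 * card W \<le> m \<Longrightarrow> card W \<le> D * card (nbhd E V' W)"
proof -
  let ?e = "\<lambda>U. card (edges_within E U)"
  let ?dense = "\<lambda>U. U \<subseteq> V \<and> U \<noteq> {} \<and> (D + 1)\<^sup>2 * card U \<le> D\<^sup>2 * ?e U"
  have finE: "finite E" using E V(1) by (meson finite_imp_finite_nsets finite_subset)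
  have fine: "finite (edges_within E U)" for U using finE by (simp add: edges_within_def)
  have D: "D > 0"
  proof (rule ccontr)
    assume "\<not> D > 0"
    then show False using dense V by auto
  qed
  have "edges_within E V = E" using E by (auto simp: edges_within_def nsets_def)
  then have "?dense V" using V dense by simp
  then obtain V' where V': "?dense V'" and least: "\<And>U. ?dense U \<Longrightarrow> card V' \<le> card U"
    using ex_has_least_nat[of ?dense V card] by blast
  have finV': "finite V'" using V' V finite_subset by blast
  show thesis
  proof (rule that[of V'])
    show "V' \<subseteq> V" using V' by simp
    show "m < card V'"
    proof (rule ccontr)
      assume "\<not> m < card V'"
      then have "D * ?e V' < (D + 1) * card V'" using sparse[of V'] V' by auto
      from mult_strict_left_mono[OF this D]
      have "D * (D * ?e V') < D * ((D + 1) * card V')" .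
      also have "\<dots> \<le> (D + 1) * ((D + 1) * card V')" by (rule mult_le_mono1) simp
      finally have "D\<^sup>2 * ?e V' < (D + 1)\<^sup>2 * card V'"
        by (simp only: power2_eq_square mult.assoc)
      then show False using V' by simp
    qed
    fix W assume W: "W \<subseteq> V'" "2 * card W \<le> m"
    show "card W \<le> D * card (nbhd E V' W)"
    proof (rule ccontr)
      assume "\<not> ?thesis"
      then have small: "D * card (nbhd E V' W) < card W" by simp
      let ?U = "W \<union> nbhd E V' W"
      have UV: "?U \<subseteq> V'" using W by (auto simp: nbhd_def)
      then have finU: "finite ?U" using finV' finite_subset by blast
      have Wne: "W \<noteq> {}" using small by auto
      have "edges_within E V' \<subseteq> edges_within E ?U \<union> edges_within E (V' - W)"
      proof
        fix e assume e: "e \<in> edges_within E V'"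
        then obtain a b where ab: "e = {a, b}" "a \<in> V'" "b \<in> V'" "{a, b} \<in> E"
          using E by (auto simp: edges_within_def nsets_def card_2_iff subset_iff)
        then have "{b, a} \<in> E" by (simp add: insert_commute)
        then show "e \<in> edges_within E ?U \<union> edges_within E (V' - W)"
          using ab by (auto simp: edges_within_def nbhd_def)
      qed
      then have "?e V' \<le> card (edges_within E ?U \<union> edges_within E (V' - W))"
        using fine by (intro card_mono) auto
      also have "\<dots> \<le> ?e ?U + ?e (V' - W)" by (rule card_Un_le)
      finally have split: "?e V' \<le> ?e ?U + ?e (V' - W)" .
      have rest: "D\<^sup>2 * ?e (V' - W) \<le> (D + 1)\<^sup>2 * card (V' - W)"
      proof (cases "V' = W")
        case True
        have "edges_within E {} = {}" using E by (auto simp: edges_within_def nsets_def)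
        then show ?thesis using True by simp
      next
        case False
        have "card (V' - W) < card V'"
          using finV' W Wne by (intro psubset_card_mono) auto
        then have "\<not> ?dense (V' - W)" using least[of "V' - W"] leD by blast
        moreover have "V' - W \<subseteq> V" "V' - W \<noteq> {}" using False V' W(1) by auto
        ultimately have "\<not> (D + 1)\<^sup>2 * card (V' - W) \<le> D\<^sup>2 * ?e (V' - W)" by blast
        then show ?thesis by (simp only: not_le less_imp_le)
      qed
      have cV: "card V' = card W + card (V' - W)"
        using finV' W by (metis card_Diff_subset card_mono finite_subset le_add_diff_inverse)
      have "(D + 1)\<^sup>2 * card V' \<le> D\<^sup>2 * ?e V'" using V' by simp
      also have "\<dots> \<le> D\<^sup>2 * (?e ?U + ?e (V' - W))" using split by simp
      also have "\<dots> \<le> D\<^sup>2 * ?e ?U + (D + 1)\<^sup>2 * card (V' - W)"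
        using rest by (simp add: distrib_left)
      finally have touch: "(D + 1)\<^sup>2 * card W \<le> D\<^sup>2 * ?e ?U"
        unfolding cV by (simp add: distrib_left)
      have cU: "card ?U \<le> card W + card (nbhd E V' W)" by (rule card_Un_le)
      have "card (nbhd E V' W) \<le> D * card (nbhd E V' W)" using D by simp
      then have "card ?U \<le> m" using cU small W(2) by linarith
      then have "D * ?e ?U < (D + 1) * card ?U"
        using sparse[of ?U] UV V' Wne by blast
      from mult_strict_left_mono[OF this D]
      have "D * (D * ?e ?U) < D * ((D + 1) * card ?U)" .
      also have "\<dots> = (D + 1) * (D * card ?U)" by (rule mult.left_commute)
      also have "\<dots> \<le> (D + 1) * (D * (card W + card (nbhd E V' W)))"
        using cU by (intro mult_left_mono) auto
      also have "\<dots> \<le> (D + 1) * ((D + 1) * card W)"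
        using small by (intro mult_left_mono) (auto simp: distrib_left)
      finally have "D\<^sup>2 * ?e ?U < (D + 1)\<^sup>2 * card W"
        by (simp only: power2_eq_square mult.assoc)
      then show False using touch by simp
    qed
  qed
qed

section \<open>A potential strategy for Maker\<close>

text \<open>
  If each of the next \<open>t\<close> moves hits any given element with probability at most \<open>1/N\<close>, then the union
  bound over the moves at which the missing elements are taken shows that the set \<open>F i\<close> is completed
  with probability at most \<open>(t/N)\<close> to the number of its elements missing from \<open>M\<close>. So \<open>danger\<close>
  bounds the expected number of sets of the family that Maker completes if he plays at random.
\<close>
definition danger :: "'i set \<Rightarrow> ('i \<Rightarrow> 'e set) \<Rightarrow> real \<Rightarrow> nat \<Rightarrow> 'e set \<Rightarrow> real" where
  "danger I F N t M = (\<Sum>i\<in>I. (real t / N) ^ card (F i - M))"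

lemma power_add_ge_linear:
  fixes y z :: real
  assumes "0 \<le> y" "0 \<le> z"
  shows "y ^ j + real j * z * y ^ (j - 1) \<le> (y + z) ^ j"
proof (induction j)
  case 0
  then show ?case by simp
next
  case (Suc j)
  have "y ^ Suc j + real (Suc j) * z * y ^ (Suc j - 1)
      \<le> (y + z) * (y ^ j + real j * z * y ^ (j - 1))"
    using assms by (cases j) (auto simp: algebra_simps)
  also have "\<dots> \<le> (y + z) * (y + z) ^ j" using Suc assms by (intro mult_left_mono) auto
  finally show ?case by simp
qed

text \<open>
  The average over \<open>A\<close> of the danger after claiming \<open>e\<close> is at most the danger before. A set with \<open>j\<close>
  missing elements loses one of them for at most \<open>j\<close> of the at least \<open>N\<close> choices of \<open>e\<close>, and for
  \<open>y = t/N\<close> the resulting bound \<open>y\<^sup>j + (j/N) y\<^sup>j\<^sup>-\<^sup>1\<close> consists of the first two terms of \<open>(y + 1/N)\<^sup>j\<close>.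
\<close>
lemma danger_average:
  assumes "finite I" "\<And>i. i \<in> I \<Longrightarrow> finite (F i)" "finite A" "A \<inter> M = {}"
    and N: "0 < N" "N \<le> real (card A)"
  shows "\<exists>e\<in>A. danger I F N t (insert e M) \<le> danger I F N (Suc t) M"
proof -
  let ?y = "real t / N"
  have one: "(\<Sum>e\<in>A. ?y ^ card (F i - insert e M)) \<le> real (card A) * (real (Suc t) / N) ^ card (F i - M)"
    if i: "i \<in> I" for i
  proof -
    let ?j = "card (F i - M)"
    have fin: "finite (F i - M)" using assms(2)[OF i] by simp
    have y: "0 \<le> ?y" using N by simp
    have "(\<Sum>e\<in>A. ?y ^ card (F i - insert e M))
        \<le> (\<Sum>e\<in>A. ?y ^ ?j + (if e \<in> F i then ?y ^ (?j - 1) else 0))"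
    proof (rule sum_mono)
      fix e assume e: "e \<in> A"
      show "?y ^ card (F i - insert e M) \<le> ?y ^ ?j + (if e \<in> F i then ?y ^ (?j - 1) else 0)"
      proof (cases "e \<in> F i")
        case True
        have "F i - insert e M = F i - M - {e}" by auto
        then have "card (F i - insert e M) = ?j - 1"
          using True e assms(4) fin by (subst card_Diff_singleton[symmetric]) auto
        then show ?thesis using True y by simp
      next
        case False
        then have "F i - insert e M = F i - M" by auto
        then show ?thesis using False by simp
      qed
    qed
    also have "\<dots> = real (card A) * ?y ^ ?j + real (card (A \<inter> F i)) * ?y ^ (?j - 1)"
      using assms(3) by (simp add: sum.distrib sum.If_cases Int_def)
    also have "\<dots> \<le> real (card A) * ?y ^ ?j + real (card A) * (real ?j * (1 / N) * ?y ^ (?j - 1))"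
    proof -
      have "card (A \<inter> F i) \<le> ?j" using fin assms(4) by (intro card_mono) auto
      then have "real (card (A \<inter> F i)) \<le> real ?j * 1" by simp
      also have "\<dots> \<le> real ?j * (real (card A) / N)"
        using N by (intro mult_left_mono) auto
      finally have "real (card (A \<inter> F i)) * ?y ^ (?j - 1) \<le> real ?j * (real (card A) / N) * ?y ^ (?j - 1)"
        using y by (intro mult_right_mono) auto
      then show ?thesis by (simp add: mult_ac)
    qed
    also have "\<dots> = real (card A) * (?y ^ ?j + real ?j * (1 / N) * ?y ^ (?j - 1))"
      by (simp add: distrib_left)
    also have "\<dots> \<le> real (card A) * (?y + 1 / N) ^ ?j"
      using y N by (intro mult_left_mono power_add_ge_linear) auto
    also have "?y + 1 / N = real (Suc t) / N" by (simp add: add_divide_distrib)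
    finally show ?thesis .
  qed
  have "(\<Sum>e\<in>A. danger I F N t (insert e M)) = (\<Sum>i\<in>I. \<Sum>e\<in>A. ?y ^ card (F i - insert e M))"
    unfolding danger_def by (rule sum.swap)
  also have "\<dots> \<le> (\<Sum>i\<in>I. real (card A) * (real (Suc t) / N) ^ card (F i - M))"
    by (intro sum_mono one)
  also have "\<dots> = (\<Sum>e\<in>A. danger I F N (Suc t) M)"
    by (simp add: danger_def sum_distrib_left)
  finally have le: "(\<Sum>e\<in>A. danger I F N t (insert e M)) \<le> (\<Sum>e\<in>A. danger I F N (Suc t) M)" .
  have "A \<noteq> {}" using N by auto
  show ?thesis
  proof (rule ccontr)
    assume "\<not> ?thesis"
    then have "(\<Sum>e\<in>A. danger I F N (Suc t) M) < (\<Sum>e\<in>A. danger I F N t (insert e M))"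
      using \<open>A \<noteq> {}\<close> assms(3) by (intro sum_strict_mono) auto
    then show False using le by simp
  qed
qed

lemma claims_snoc:
  "maker_claims (h @ [(e, B)]) = insert e (maker_claims h)"
  "breaker_claims (h @ [(e, B)]) = B \<union> breaker_claims h"
  by (auto simp: maker_claims_def breaker_claims_def)

lemma card_maker_claims:
  assumes "consistent_play X b s h"
  shows "card (maker_claims h) = length h"
  using assms
proof induction
  case start
  then show ?case by (simp add: maker_claims_def)
next
  case (round h F)
  have "finite (maker_claims h)" by (simp add: maker_claims_def)
  moreover have "s h \<notin> maker_claims h" using round by (simp add: free_elems_def)
  ultimately show ?case using round by (simp add: claims_snoc)
qed

lemma card_claims_le:
  assumes "consistent_play X b s h"
  shows "card (maker_claims h \<union> breaker_claims h) \<le> length h * (b + 1)"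
  using assms
proof induction
  case start
  then show ?case by (simp add: maker_claims_def breaker_claims_def)
next
  case (round h F)
  have eq: "maker_claims (h @ [(s h, F)]) \<union> breaker_claims (h @ [(s h, F)])
      = (maker_claims h \<union> breaker_claims h) \<union> insert (s h) F"
    by (auto simp: claims_snoc)
  have "card (maker_claims (h @ [(s h, F)]) \<union> breaker_claims (h @ [(s h, F)]))
      \<le> card (maker_claims h \<union> breaker_claims h) + card (insert (s h) F)"
    unfolding eq by (rule card_Un_le)
  also have "card (insert (s h) F) \<le> Suc (card F)" by (simp add: card_insert_le_m1)
  also have "card F \<le> b" using round by simp
  finally show ?case using round by simp
qed

lemma consistent_play_take:
  assumes "consistent_play X b s h"
  shows "consistent_play X b s (take T h)"
  using assms
proof (induction arbitrary: T)
  case start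
  then show ?case by (simp add: consistent_play.start)
next
  case (round h F)
  show ?case
  proof (cases "T \<le> length h")
    case True
    then show ?thesis using round by simp
  next
    case False
    then show ?thesis using consistent_play.round[OF round(1-4)] by simp
  qed
qed

lemma card_free_elems_ge:
  assumes "consistent_play X b s h" "finite X" "length h \<le> T"
  shows "card X \<le> card (free_elems X h) + T * (b + 1)"
proof -
  let ?C = "maker_claims h \<union> breaker_claims h"
  have "card X = card (X - ?C) + card (X \<inter> ?C)"
    using assms(2) by (metis Diff_disjoint Int_Diff_Un Int_Diff_disjoint card_Un_disjoint finite_Diff finite_Int inf_commute sup_commute)
  moreover have "card (X \<inter> ?C) \<le> T * (b + 1)"
  proof (cases "finite ?C")
    case True
    have "card (X \<inter> ?C) \<le> card ?C" using True by (intro card_mono) auto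
    also have "\<dots> \<le> length h * (b + 1)" by (rule card_claims_le[OF assms(1)])
    also have "\<dots> \<le> T * (b + 1)" using assms(3) by (rule mult_le_mono1)
    finally show ?thesis .
  next
    case False
    \<comment> \<open>The cardinality of an infinite set is 0, so the bound on the claims needs them to be finite.\<close>
    have "snd ` set h \<subseteq> Pow X"
      using assms(1) by induction (auto simp: free_elems_def)
    then have "?C \<subseteq> X \<union> maker_claims h" by (auto simp: breaker_claims_def)
    then have "finite ?C" using assms(2) by (auto simp: maker_claims_def intro: finite_subset)
    then show ?thesis using False by simp
  qed
  ultimately show ?thesis by (simp add: free_elems_def)
qed

text \<open>
  Maker always claims a free element that minimises the danger of the next position. Breaker's moves
  do not change the danger, so it stays below 1 through the first \<open>T\<close> rounds. When no
  rounds are left, each completed set contributes \<open>0\<^sup>0 = 1\<close>, hence none is completed. The graph \<open>G\<close>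
  consists of Maker's claims in these rounds; his later claims only enlarge it.
\<close>
proposition maker_avoids_family:
  fixes F :: "'i \<Rightarrow> 'e set" and N :: real
  assumes X: "finite X" and I: "finite I" "\<And>i. i \<in> I \<Longrightarrow> finite (F i)"
    and N: "0 < N" "real (T * (b + 1)) + N \<le> real (card X)"
    and light: "(\<Sum>i\<in>I. (real T / N) ^ card (F i)) < 1"
  shows "\<exists>s. maker_strategy X b s \<and>
    maker_guarantees X b s (\<lambda>M. \<exists>G\<subseteq>M. card G = T \<and> (\<forall>i\<in>I. \<not> F i \<subseteq> G))"
proof -
  \<comment> \<open>From round \<open>T\<close> on the subtraction truncates to 0; Maker still gets a legal move from it.\<close>
  define val where
    "val h e = danger I F N (T - Suc (length h)) (insert e (maker_claims h))" for h e
  define s where "s h = arg_min_on (val h) (free_elems X h)" for h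
  have finfree: "finite (free_elems X h)" for h using X by (simp add: free_elems_def)
  have legal: "s h \<in> free_elems X h" if "free_elems X h \<noteq> {}" for h
    unfolding s_def using that finfree by (intro arg_min_if_finite)
  have best: "val h (s h) \<le> val h e" if "e \<in> free_elems X h" for h e
    unfolding s_def using that finfree by (intro arg_min_least) auto
  have many: "N \<le> real (card (free_elems X h))" if "consistent_play X b s h" "length h \<le> T" for h
  proof -
    have "real (card X) \<le> real (card (free_elems X h) + T * (b + 1))"
      using card_free_elems_ge[OF that(1) X that(2)] by (rule of_nat_mono)
    then show ?thesis using N(2) by simp
  qed
  have inv: "danger I F N (T - length h) (maker_claims h) < 1"
    if "consistent_play X b s h" "length h \<le> T" for h
    using that
  proof induction
    case start
    then show ?case using light by (simp add: danger_def maker_claims_def)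
  next
    case (round h B)
    then have len: "length h < T" by simp
    have "free_elems X h \<inter> maker_claims h = {}" by (auto simp: free_elems_def)
    moreover have "N \<le> real (card (free_elems X h))" using many round(1) len by simp
    ultimately obtain e where "e \<in> free_elems X h"
      "val h e \<le> danger I F N (Suc (T - Suc (length h))) (maker_claims h)"
      using danger_average[where F = F and N = N and M = "maker_claims h" and t = "T - Suc (length h)",
        OF I finfree] N(1)
      by (auto simp: val_def)
    then have "val h (s h) \<le> danger I F N (T - length h) (maker_claims h)"
      using best[of e h] len by (simp add: Suc_diff_Suc)
    then show ?case using round.IH len by (simp add: val_def claims_snoc)
  qed
  show ?thesis
  proof (intro exI[of _ s] conjI)
    show "maker_strategy X b s" using legal by (simp add: maker_strategy_def)
    show "maker_guarantees X b s (\<lambda>M. \<exists>G\<subseteq>M. card G = T \<and> (\<forall>i\<in>I. \<not> F i \<subseteq> G))"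
      unfolding maker_guarantees_def
    proof (intro allI impI)
      fix h assume h: "consistent_play X b s h" "free_elems X h = {}"
      then have "\<not> length h \<le> T" using many[of h] N(1) by auto
      then have len: "length (take T h) = T" by simp
      let ?G = "maker_claims (take T h)"
      note play = consistent_play_take[OF h(1), of T]
      have "?G \<subseteq> maker_claims h" by (auto simp: maker_claims_def dest: in_set_takeD)
      moreover have "card ?G = T" using card_maker_claims[OF play] len by simp
      moreover have "\<not> F i \<subseteq> ?G" if i: "i \<in> I" for i
      proof
        assume "F i \<subseteq> ?G"
        then have "1 = (real 0 / N) ^ card (F i - ?G)" by (simp add: Diff_eq_empty_iff[THEN iffD2])
        also have "\<dots> \<le> danger I F N 0 ?G"
          unfolding danger_def by (rule member_le_sum[OF i _ I(1)]) (use N(1) in simp)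
        also have "\<dots> < 1" using inv[OF play] len by simp
        finally show False by simp
      qed
      ultimately show "\<exists>G\<subseteq>maker_claims h. card G = T \<and> (\<forall>i\<in>I. \<not> F i \<subseteq> G)" by blast
    qed
  qed
qed

section \<open>Counting locally dense edge sets\<close>

text \<open>
  The quotient \<open>u / D\<close> rounded up: \<open>u\<close> vertices with edge density at least \<open>1 + 1/D\<close> span at least
  \<open>u + excess D u\<close> edges.
\<close>
definition excess :: "nat \<Rightarrow> nat \<Rightarrow> nat" where
  "excess D u = (u + D - 1) div D"

text \<open>
  The edge set \<open>F\<close> is paired with the vertex set \<open>U\<close> that it witnesses to be dense, so that the
  sum over the family splits exactly according to the size of \<open>U\<close>.
\<close>
definition dense_spots :: "nat \<Rightarrow> nat \<Rightarrow> nat \<Rightarrow> (nat set \<times> nat set set) set" where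
  "dense_spots D m n = (SIGMA U:{U. U \<subseteq> {..<n} \<and> U \<noteq> {} \<and> card U \<le> m}.
     {F. F \<subseteq> [U]\<^bsup>2\<^esup> \<and> card F = card U + excess D (card U)})"

lemma excess_bounds:
  assumes "D > 0" "u > 0"
  shows "u \<le> D * excess D u" "0 < excess D u" and "D * m \<ge> (D + 1) * u \<Longrightarrow> u + excess D u \<le> m"
proof -
  have "u + D - 1 = D * excess D u + (u + D - 1) mod D" by (simp add: excess_def)
  moreover have "(u + D - 1) mod D < D" using assms by simp
  ultimately show *: "u \<le> D * excess D u" using assms by linarith
  then show "0 < excess D u" using assms by (cases "excess D u") auto
  assume m: "D * m \<ge> (D + 1) * u"
  show "u + excess D u \<le> m"
  proof (rule ccontr)
    assume "\<not> ?thesis"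
    then have "Suc m \<le> u + excess D u" by simp
    then have "D * Suc m \<le> D * (u + excess D u)" by (rule mult_le_mono2)
    moreover have "D * excess D u \<le> u + D - 1" by (simp add: excess_def)
    ultimately show False using m assms by (simp add: algebra_simps)
  qed
qed

text \<open>The term of index \<open>m\<close> in the exponential series of \<open>m\<close> gives \<open>m\<^sup>m / m! \<le> e\<^sup>m\<close>.\<close>
lemma binomial_le_exp_power:
  assumes "m > 0"
  shows "real (N choose m) \<le> (exp 1 * real N / real m) ^ m"
proof -
  have "(\<Sum>i\<in>{m}. inverse (fact i) * real m ^ i) \<le> (\<Sum>i. inverse (fact i) * real m ^ i)"
    by (intro sum_le_suminf) (auto intro: summable_exp)
  then have e: "real m ^ m / fact m \<le> exp (real m)"
    by (simp add: exp_def divide_inverse scaleR_conv_of_real mult.commute)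
  have "real (N choose m) * fact m \<le> real N ^ m"
    using binomial_fact_pow[of N m] by (metis of_nat_fact of_nat_le_iff of_nat_mult of_nat_power)
  then have "real (N choose m) \<le> real N ^ m / fact m" by (simp add: field_simps)
  also have "\<dots> = real N ^ m / real m ^ m * (real m ^ m / fact m)" using assms by simp
  also have "\<dots> \<le> real N ^ m / real m ^ m * exp (real m)" using e by (intro mult_left_mono) auto
  also have "exp (real m) = exp 1 ^ m" by (simp add: exp_of_nat_mult[symmetric])
  finally show ?thesis by (simp add: power_mult_distrib power_divide mult_ac)
qed

text \<open>
  With \<open>x = K u / n\<close> and \<open>j = excess D u\<close>, the two binomial bounds show that the term is at most
  \<open>(e n / u)\<^sup>u x\<^sup>u\<^sup>+\<^sup>j = (e K)\<^sup>u x\<^sup>j\<close>. The \<open>j\<close> extra edges have to pay for the exponential factor,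
  and they can because \<open>u \<le> D j\<close>: the product is at most \<open>(L u / n)\<^sup>j\<close>. One factor \<open>L u / n\<close> provides
  the \<open>1/n\<close>. The others are at most \<open>(1/4)\<^sup>D\<close> each by the bound on \<open>u\<close>, which makes the sum over \<open>u\<close>
  geometric.
\<close>
lemma dense_spot_term_le:
  fixes Q :: real and D n u :: nat
  assumes D: "D > 0" and Q: "1 \<le> Q" and u: "0 < u" "0 < n"
    and K: "K = exp 1 * Q" and L: "L = (exp 1 * K) ^ D * K"
    and small: "real u \<le> (1/4) ^ D / L * real n"
  shows "real (n choose u) * real ((u choose 2) choose (u + excess D u)) * (Q / n) ^ (u + excess D u)
    \<le> L * 4 ^ D / n * (1/2) ^ u"
proof -
  define j where "j = excess D u"
  define x where "x = K * u / n"
  have j: "u \<le> D * j" "0 < j" using excess_bounds[OF D u(1)] by (auto simp: j_def)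
  have e1: "1 \<le> exp (1::real)" by simp
  have K1: "1 \<le> K" unfolding K using mult_mono[OF e1 Q] by simp
  have eK: "1 \<le> exp 1 * K" using mult_mono[OF e1 K1] by simp
  have L0: "0 < L" using K1 by (simp add: L)
  have x0: "0 \<le> x" using K1 by (simp add: x_def)
  have "real ((u choose 2) choose (u + j)) \<le> real ((u\<^sup>2) choose (u + j))"
  proof -
    have "u choose 2 \<le> u\<^sup>2"
      using binomial_le_pow[of 2 u] u by (cases "2 \<le> u") (auto simp: binomial_eq_0)
    then show ?thesis by (simp add: binomial_right_mono)
  qed
  also have "\<dots> \<le> (exp 1 * real (u\<^sup>2) / real (u + j)) ^ (u + j)"
    using u by (intro binomial_le_exp_power) auto
  also have "\<dots> \<le> (exp 1 * real u) ^ (u + j)"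
    using u by (intro power_mono) (auto simp: field_simps power2_eq_square)
  finally have "real ((u choose 2) choose (u + j)) * (Q / n) ^ (u + j) \<le> (exp 1 * real u) ^ (u + j) * (Q / n) ^ (u + j)"
    using Q by (intro mult_right_mono) auto
  also have "\<dots> = x ^ (u + j)"
    by (simp add: power_mult_distrib[symmetric] x_def K mult_ac)
  finally have b2: "real ((u choose 2) choose (u + j)) * (Q / n) ^ (u + j) \<le> x ^ (u + j)" .
  have "real (n choose u) * (real ((u choose 2) choose (u + j)) * (Q / n) ^ (u + j))
      \<le> (exp 1 * n / u) ^ u * x ^ (u + j)"
    using Q u by (intro mult_mono binomial_le_exp_power b2) auto
  also have "\<dots> = (exp 1 * K) ^ u * x ^ j"
    using u by (simp add: power_add power_mult_distrib[symmetric] x_def mult_ac)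
  also have "\<dots> \<le> (exp 1 * K) ^ (D * j) * x ^ j"
    using eK j x0 by (intro mult_right_mono power_increasing) auto
  also have "\<dots> = (L * u / n) ^ j"
    by (simp add: power_mult power_mult_distrib[symmetric] L x_def mult_ac)
  also have "\<dots> = (L * u / n) * (L * u / n) ^ (j - 1)"
    using j(2) by (cases j) auto
  also have "\<dots> \<le> (L * u / n) * ((1/4) ^ D) ^ (j - 1)"
    using small L0 u by (intro mult_left_mono power_mono) (auto simp: field_simps)
  also have "((1/4::real) ^ D) ^ (j - 1) = 4 ^ D * (1/4) ^ (D * j)"
    using j(2) by (cases j) (auto simp: power_mult[symmetric] power_add power_one_over field_simps)
  also have "(L * u / n) * (4 ^ D * (1/4) ^ (D * j)) \<le> (L * 2 ^ u / n) * (4 ^ D * (1/4) ^ u)"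
  proof (intro mult_mono divide_right_mono)
    have "real u \<le> real (2 ^ u)" using less_exp[of u] by (intro of_nat_mono) simp
    then show "real u \<le> 2 ^ u" by simp
    show "(1/4::real) ^ (D * j) \<le> (1/4) ^ u" using j(1) by (intro power_decreasing) auto
  qed (use L0 in auto)
  also have "\<dots> = L * 4 ^ D / n * (1/2) ^ u"
  proof -
    have "(2::real) ^ u * (1/4) ^ u = (1/2) ^ u" by (simp add: power_mult_distrib[symmetric])
    then show ?thesis by simp
  qed
  finally show ?thesis by (simp add: j_def mult.assoc)
qed

lemma finite_dense_spots:
  "finite (dense_spots D m n)"
  "(U, F) \<in> dense_spots D m n \<Longrightarrow> finite F"
proof -
  have *: "finite ([U]\<^bsup>2\<^esup>)" if "U \<subseteq> {..<n}" for U :: "nat set"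
    using that by (meson finite_imp_finite_nsets finite_lessThan finite_subset)
  show "finite (dense_spots D m n)"
    unfolding dense_spots_def
  proof (rule finite_SigmaI)
    show "finite {U. U \<subseteq> {..<n} \<and> U \<noteq> {} \<and> card U \<le> m}"
      by (rule finite_subset[of _ "Pow {..<n}"]) auto
    fix U assume "U \<in> {U. U \<subseteq> {..<n} \<and> U \<noteq> {} \<and> card U \<le> m}"
    then show "finite {F. F \<subseteq> [U]\<^bsup>2\<^esup> \<and> card F = card U + excess D (card U)}"
      using *[of U] by (auto intro: finite_subset[of _ "Pow ([U]\<^bsup>2\<^esup>)"])
  qed
  show "(U, F) \<in> dense_spots D m n \<Longrightarrow> finite F"
    using *[of U] by (auto simp: dense_spots_def intro: finite_subset)
qed

lemma sum_dense_spots: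
  fixes q :: real
  shows "(\<Sum>p\<in>dense_spots D m n. q ^ card (snd p)) =
    (\<Sum>u=1..m. real (n choose u) * real ((u choose 2) choose (u + excess D u)) * q ^ (u + excess D u))"
proof -
  let ?S = "{U. U \<subseteq> {..<n} \<and> U \<noteq> {} \<and> card U \<le> m}"
  let ?g = "\<lambda>u. real ((u choose 2) choose (u + excess D u)) * q ^ (u + excess D u)"
  have finS: "finite ?S" by (rule finite_subset[of _ "Pow {..<n}"]) auto
  have fin2: "finite ([U]\<^bsup>2\<^esup>)" if "U \<in> ?S" for U
    using that by (auto intro!: finite_imp_finite_nsets intro: finite_subset)
  have "(\<Sum>p\<in>dense_spots D m n. q ^ card (snd p)) =
      (\<Sum>U\<in>?S. \<Sum>F\<in>{F. F \<subseteq> [U]\<^bsup>2\<^esup> \<and> card F = card U + excess D (card U)}. q ^ card F)"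
    unfolding dense_spots_def
    by (subst sum.Sigma[OF finS]) (use fin2 in \<open>auto simp: split_def intro: finite_subset[of _ "Pow ([_]\<^bsup>2\<^esup>)"]\<close>)
  also have "\<dots> = (\<Sum>U\<in>?S. ?g (card U))"
    by (intro sum.cong refl) (use fin2 in \<open>simp add: n_subsets card_nsets\<close>)
  also have "\<dots> = (\<Sum>u=1..m. \<Sum>U\<in>{U \<in> ?S. card U = u}. ?g (card U))"
  proof (rule sum.group[symmetric, OF finS])
    show "card ` ?S \<subseteq> {1..m}"
      by (auto simp: Suc_le_eq card_gt_0_iff dest: finite_subset[OF _ finite_lessThan])
  qed simp
  also have "\<dots> = (\<Sum>u=1..m. real (n choose u) * ?g u)"
  proof (rule sum.cong[OF refl])
    fix u assume "u \<in> {1..m}"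
    then have "{U \<in> ?S. card U = u} = {U. U \<subseteq> {..<n} \<and> card U = u}" by auto
    then show "(\<Sum>U\<in>{U \<in> ?S. card U = u}. ?g (card U)) = real (n choose u) * ?g u"
      by (simp add: n_subsets)
  qed
  finally show ?thesis by (simp add: mult.assoc)
qed

text \<open>Summing the geometric bounds leaves \<open>L 4\<^sup>D / n\<close>, which is below 1 for large \<open>n\<close>.\<close>
lemma dense_spots_light:
  fixes Q :: real
  assumes D: "D > 0" and Q: "1 \<le> Q"
  obtains \<alpha> :: real and n\<^sub>0 :: nat where "0 < \<alpha>"
    "\<And>n m q. n > n\<^sub>0 \<Longrightarrow> real m \<le> \<alpha> * real n \<Longrightarrow> 0 \<le> q \<Longrightarrow> q \<le> Q / real n \<Longrightarrow>
      (\<Sum>p\<in>dense_spots D m n. q ^ card (snd p)) < 1"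
proof -
  define K where "K = exp 1 * Q"
  define L where "L = (exp 1 * K) ^ D * K"
  have L0: "0 < L" using Q by (simp add: L_def K_def)
  have "(\<Sum>p\<in>dense_spots D m n. q ^ card (snd p)) < 1"
    if n: "n > nat \<lceil>L * 4 ^ D\<rceil>" and m: "real m \<le> (1/4) ^ D / L * real n"
      and q: "0 \<le> q" "q \<le> Q / real n" for m n q
  proof -
    have n0: "0 < n" and nL: "L * 4 ^ D < real n" using n by linarith+
    have "(\<Sum>p\<in>dense_spots D m n. q ^ card (snd p)) \<le> (\<Sum>u=1..m. L * 4 ^ D / n * (1/2) ^ u)"
      unfolding sum_dense_spots
    proof (rule sum_mono)
      fix u assume u: "u \<in> {1..m}"
      have "real (n choose u) * real ((u choose 2) choose (u + excess D u)) * q ^ (u + excess D u)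
        \<le> real (n choose u) * real ((u choose 2) choose (u + excess D u)) * (Q / n) ^ (u + excess D u)"
        using q by (intro mult_left_mono power_mono) auto
      also have "\<dots> \<le> L * 4 ^ D / n * (1/2) ^ u"
        using u m n0 by (intro dense_spot_term_le[OF D Q _ _ K_def L_def]) auto
      finally show "real (n choose u) * real ((u choose 2) choose (u + excess D u)) * q ^ (u + excess D u)
        \<le> L * 4 ^ D / n * (1/2) ^ u" .
    qed
    also have "\<dots> = L * 4 ^ D / n * (\<Sum>u=1..m. (1/2) ^ u)" by (simp add: sum_distrib_left)
    also have "(\<Sum>u=1..m. (1/2::real) ^ u) = 1 - (1/2) ^ m" by (induction m) auto
    also have "L * 4 ^ D / n * (1 - (1/2) ^ m) \<le> L * 4 ^ D / n * 1"
      using L0 by (intro mult_left_mono) auto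
    also have "\<dots> < 1" using nL n0 by simp
    finally show ?thesis .
  qed
  moreover have "0 < (1/4) ^ D / L" using L0 by simp
  ultimately show thesis using that by blast
qed

section \<open>Long cycles in Maker's graph\<close>

text \<open>
  Expansion holds for sets of size at most \<open>k = m div 2\<close>, so sets of size at least \<open>k/2\<close> have
  at least \<open>t = k div (2 D)\<close> neighbours; \<open>16 D \<le> m\<close> makes \<open>t\<close> at least 2, and the rounding in both
  divisions is absorbed by the factor 8.
\<close>
lemma long_cycle_of_sparse:
  fixes E :: "nat set set"
  assumes D: "0 < D" and n: "0 < n" and E: "E \<subseteq> complete_graph_edges n"
    and dense: "(D + 1)\<^sup>2 * n \<le> D\<^sup>2 * card E"
    and spots: "\<And>p. p \<in> dense_spots D m n \<Longrightarrow> \<not> snd p \<subseteq> E"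
    and m: "16 * D \<le> m"
  shows "\<exists>vs. is_cycle E vs \<and> m \<le> 8 * D * length vs"
proof -
  have sparse: "D * card (edges_within E U) < (D + 1) * card U"
    if U: "U \<subseteq> {..<n}" "U \<noteq> {}" "card U \<le> m" for U
  proof (rule ccontr)
    assume "\<not> ?thesis"
    then have "(D + 1) * card U \<le> D * card (edges_within E U)" by simp
    moreover have "0 < card U" using U by (auto simp: card_gt_0_iff intro: finite_subset)
    ultimately have "card U + excess D (card U) \<le> card (edges_within E U)"
      using excess_bounds(3)[OF D] by blast
    then obtain F where F: "F \<subseteq> edges_within E U" "card F = card U + excess D (card U)"
      by (meson obtain_subset_with_card_n)
    moreover have "edges_within E U \<subseteq> [U]\<^bsup>2\<^esup>"
      using E by (auto simp: edges_within_def complete_graph_edges_def nsets_def)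
    ultimately have "(U, F) \<in> dense_spots D m n" using U by (auto simp: dense_spots_def)
    moreover have "F \<subseteq> E" using F by (auto simp: edges_within_def)
    ultimately show False using spots[of "(U, F)"] by simp
  qed
  obtain V where V: "V \<subseteq> {..<n}" "m < card V"
    and exp: "\<And>W. W \<subseteq> V \<Longrightarrow> 2 * card W \<le> m \<Longrightarrow> card W \<le> D * card (nbhd E V W)"
    using expanding_subset_of_locally_sparse[of "{..<n}" E D m] n E dense sparse
    by (auto simp: complete_graph_edges_def)
  define k where "k = m div 2"
  define t where "t = k div (2 * D)"
  have "4 * D \<le> k" using m by (simp add: k_def)
  then have t2: "2 \<le> t" using D by (simp add: t_def less_eq_div_iff_mult_less_eq)
  have "\<exists>vs. is_cycle E vs \<and> t < length vs"
  proof (rule cycle_of_expansion[of V k])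
    show "finite V" using V finite_subset by blast
    show "k \<le> card V" using V by (simp add: k_def)
    show "2 \<le> t" by fact
    fix W assume W: "W \<subseteq> V" "k \<le> 2 * card W" "card W \<le> k"
    then have "card W \<le> D * card (nbhd E V W)" using exp by (simp add: k_def)
    then have "k \<le> 2 * (D * card (nbhd E V W))" using W by linarith
    then have "k \<le> card (nbhd E V W) * (2 * D)" by (simp add: mult_ac)
    then show "t \<le> card (nbhd E V W)"
      using D by (simp add: t_def) (metis div_le_mono nonzero_mult_div_cancel_right mult_is_0 not_gr_zero zero_neq_numeral)
  qed
  then obtain vs where vs: "is_cycle E vs" "Suc t \<le> length vs" by auto
  have "k < 2 * D * Suc t"
    using D dividend_less_times_div[of "2 * D" k] by (simp add: t_def)
  also have "\<dots> \<le> 2 * D * length vs" using vs(2) by (rule mult_le_mono2)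
  finally have "2 * k + 1 \<le> 8 * D * length vs" by simp
  moreover have "m \<le> 2 * k + 1" by (simp add: k_def)
  ultimately have "m \<le> 8 * D * length vs" by linarith
  with vs show ?thesis by blast
qed

lemma is_cycle_mono: "is_cycle E vs \<Longrightarrow> E \<subseteq> E' \<Longrightarrow> is_cycle E' vs"
  by (auto simp: is_cycle_def)

lemma maker_claims_subset:
  assumes "consistent_play X b s h" shows "maker_claims h \<subseteq> X"
  using assms by induction (auto simp: claims_snoc free_elems_def maker_claims_def)

theorem theorem6:
  fixes \<epsilon> :: real
  assumes "0 < \<epsilon>" and "\<epsilon> < 1"
  shows "\<exists>c::real. c > 0 \<and> (\<exists>n\<^sub>0::nat. \<forall>n>n\<^sub>0. \<forall>b::nat.
    1 \<le> b \<and> real b \<le> (1 - \<epsilon>) * real n / 2 \<longrightarrow>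
    (\<exists>s. maker_strategy (complete_graph_edges n) b s \<and>
         maker_guarantees (complete_graph_edges n) b s
           (\<lambda>E. \<exists>vs. is_cycle E vs \<and> real (length vs) \<ge> c * real n)))"
proof -
  \<comment> \<open>\<open>1/D \<le> \<epsilon>/16\<close> gives \<open>(1 + 1/D)\<^sup>2 \<le> 1 + \<epsilon>/4\<close>; \<open>Q / n\<close> will bound the probability that random
     play claims a given edge within the first \<open>T \<le> 2 n\<close> rounds.\<close>
  define D where "D = nat \<lceil>16 / \<epsilon>\<rceil>"
  define Q where "Q = 8 / \<epsilon>"
  have "16 / \<epsilon> \<le> real D" unfolding D_def by linarith
  then have De: "16 \<le> \<epsilon> * real D" using assms(1) by (simp add: field_simps)
  then have D: "0 < D" by (cases D) auto
  have Q: "1 \<le> Q" using assms by (simp add: Q_def field_simps)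
  obtain \<alpha> n1 where \<alpha>: "0 < \<alpha>"
    and light: "\<And>n m q. n > n1 \<Longrightarrow> real m \<le> \<alpha> * real n \<Longrightarrow> 0 \<le> q \<Longrightarrow> q \<le> Q / real n \<Longrightarrow>
      (\<Sum>p\<in>dense_spots D m n. q ^ card (snd p)) < 1"
    by (rule dense_spots_light[OF D Q]) blast
  define c where "c = \<alpha> / (16 * D)"
  \<comment> \<open>\<open>n2\<close> makes linear terms negligible against \<open>\<epsilon> n\<^sup>2\<close>; \<open>n3\<close> makes the integer part \<open>m\<close> of \<open>\<alpha> n\<close> at
     least \<open>16 D\<close> and more than half of \<open>\<alpha> n\<close>.\<close>
  define n2 where "n2 = nat \<lceil>40 / \<epsilon>\<rceil>"
  define n3 where "n3 = nat \<lceil>(16 * D + 2) / \<alpha>\<rceil>"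
  have "\<exists>s. maker_strategy (complete_graph_edges n) b s \<and>
         maker_guarantees (complete_graph_edges n) b s
           (\<lambda>E. \<exists>vs. is_cycle E vs \<and> real (length vs) \<ge> c * real n)"
    if n: "n > max n1 (max n2 n3)" and b: "real b \<le> (1 - \<epsilon>) * real n / 2" for n b
  proof -
    have "40 / \<epsilon> < real n" using n unfolding n2_def by linarith
    then have ne: "40 < \<epsilon> * real n" using assms by (simp add: field_simps)
    also have "\<dots> \<le> 1 * real n" using assms by (intro mult_right_mono) auto
    finally have n40: "40 < real n" by simp
    have "(16 * D + 2) / \<alpha> < real n" using n unfolding n3_def by linarith
    then have n\<alpha>: "16 * D + 2 < \<alpha> * real n" using \<alpha> by (simp add: field_simps)
    define m where "m = nat \<lfloor>\<alpha> * real n\<rfloor>"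
    have m: "real m \<le> \<alpha> * real n" "\<alpha> * real n < real m + 1"
      using n\<alpha> by (auto simp: m_def)
    have mD: "16 * D \<le> m" using n\<alpha> m by linarith
    define T where "T = nat \<lceil>(1 + \<epsilon> / 4) * real n\<rceil>"
    have T: "(1 + \<epsilon> / 4) * real n \<le> real T" "real T \<le> (1 + \<epsilon> / 4) * real n + 1"
      using assms by (auto simp: T_def)
    \<comment> \<open>A lower bound on the number of free edges in each of the first \<open>T\<close> rounds.\<close>
    define N where "N = \<epsilon> * (real n)\<^sup>2 / 4"
    have N0: "0 < N" using assms n40 by (simp add: N_def)
    let ?X = "complete_graph_edges n"
    have finX: "finite ?X" by (simp add: complete_graph_edges_def finite_imp_finite_nsets)
    have cX: "real (card ?X) = (real n)\<^sup>2 / 2 - real n / 2"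
    proof -
      have "card ?X = n * (n - 1) div 2" by (simp add: complete_graph_edges_def card_nsets choose_two)
      moreover have "even (n * (n - 1))" by (cases n) auto
      ultimately have "2 * card ?X = n * (n - 1)" by simp
      then have "real (2 * card ?X) = real (n * (n - 1))" by (simp only:)
      then have "2 * real (card ?X) = real n * (real n - 1)"
        using n40 by (simp add: of_nat_diff)
      then show ?thesis by (simp add: power2_eq_square algebra_simps)
    qed
    \<comment> \<open>The \<open>T\<close> rounds use about \<open>(1 + \<epsilon>/4) (1 - \<epsilon>) n\<^sup>2 / 2 \<le> (1 - 3\<epsilon>/4) n\<^sup>2 / 2\<close> edges. So about
       \<open>3\<epsilon> n\<^sup>2 / 8\<close> edges stay free, and the part above \<open>N\<close> covers the linear error terms.\<close>
    have room: "real (T * (b + 1)) + N \<le> real (card ?X)"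
    proof -
      have "real (T * (b + 1)) = real T * (real b + 1)" by (simp add: algebra_simps)
      also have "\<dots> \<le> ((1 + \<epsilon> / 4) * real n + 1) * ((1 - \<epsilon>) * real n / 2 + 1)"
        using T b assms by (intro mult_mono) auto
      also have "\<dots> = (1 - 3 * \<epsilon> / 4 - \<epsilon>\<^sup>2 / 4) * (real n)\<^sup>2 / 2 + (3/2 - \<epsilon> / 4) * real n + 1"
        by (simp add: power2_eq_square field_simps)
      also have "\<dots> \<le> (1 - 3 * \<epsilon> / 4) * (real n)\<^sup>2 / 2 + 3/2 * real n + 1"
        using assms by (intro add_mono divide_right_mono mult_right_mono) auto
      also have "\<dots> = (real n)\<^sup>2 / 2 - 3 / 8 * (\<epsilon> * (real n)\<^sup>2) + 3/2 * real n + 1"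
        by (simp add: field_simps)
      finally have 1: "real (T * (b + 1)) \<le>
        (real n)\<^sup>2 / 2 - 3 / 8 * (\<epsilon> * (real n)\<^sup>2) + 3/2 * real n + 1" .
      have "40 * real n \<le> \<epsilon> * real n * real n" using ne by (intro mult_right_mono) auto
      then have "40 * real n \<le> \<epsilon> * (real n)\<^sup>2" by (simp add: power2_eq_square mult.assoc)
      then show ?thesis using 1 n40 unfolding cX N_def by linarith
    qed
    have "real T / N \<le> 2 * real n / N"
    proof (rule divide_right_mono)
      have "(1 + \<epsilon> / 4) * real n \<le> (5 / 4) * real n" using assms by (intro mult_right_mono) auto
      then show "real T \<le> 2 * real n" using T(2) n40 by linarith
    qed (use N0 in simp)
    also have "\<dots> = Q / real n"
      using n40 assms by (simp add: N_def Q_def power2_eq_square field_simps)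
    finally have q: "real T / N \<le> Q / real n" .
    have light': "(\<Sum>p\<in>dense_spots D m n. (real T / N) ^ card (snd p)) < 1"
      using n m(1) q N0 by (intro light) auto
    have fin: "finite (snd p)" if "p \<in> dense_spots D m n" for p
      using that finite_dense_spots(2)[of "fst p" "snd p"] by simp
    obtain s where s: "maker_strategy ?X b s"
      and g: "maker_guarantees ?X b s
        (\<lambda>M. \<exists>G\<subseteq>M. card G = T \<and> (\<forall>p\<in>dense_spots D m n. \<not> snd p \<subseteq> G))"
      using maker_avoids_family[where F = snd, OF finX finite_dense_spots(1) fin N0 room light']
      by blast
    have edges: "(D + 1)\<^sup>2 * n \<le> D\<^sup>2 * T"
    proof -
      have "(real D + 1)\<^sup>2 \<le> (real D)\<^sup>2 * (1 + \<epsilon> / 4)"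
      proof -
        have "16 * real D \<le> \<epsilon> * real D * real D" using De by (intro mult_right_mono) auto
        then have "16 * real D \<le> (real D)\<^sup>2 * \<epsilon>" by (simp add: power2_eq_square mult_ac)
        moreover have "(real D + 1)\<^sup>2 = (real D)\<^sup>2 + 2 * real D + 1"
          by (simp add: power2_eq_square algebra_simps)
        moreover have "1 \<le> real D" using D by simp
        moreover have "(real D)\<^sup>2 * (1 + \<epsilon> / 4) = (real D)\<^sup>2 + (real D)\<^sup>2 * \<epsilon> / 4"
          by (simp add: distrib_left)
        ultimately show ?thesis by linarith
      qed
      then have "(real D + 1)\<^sup>2 * real n \<le> (real D)\<^sup>2 * (1 + \<epsilon> / 4) * real n"
        by (rule mult_right_mono) simp
      also have "\<dots> \<le> (real D)\<^sup>2 * real T" using T(1) by (simp add: mult.assoc mult_left_mono)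
      finally have "real ((D + 1)\<^sup>2 * n) \<le> real (D\<^sup>2 * T)" by (simp add: add.commute)
      then show ?thesis by (simp only: of_nat_le_iff)
    qed
    have "maker_guarantees ?X b s (\<lambda>E. \<exists>vs. is_cycle E vs \<and> real (length vs) \<ge> c * real n)"
      unfolding maker_guarantees_def
    proof (intro allI impI)
      fix h assume h: "consistent_play ?X b s h" "free_elems ?X h = {}"
      then obtain G where G: "G \<subseteq> maker_claims h" "card G = T"
        "\<And>p. p \<in> dense_spots D m n \<Longrightarrow> \<not> snd p \<subseteq> G"
        using g[unfolded maker_guarantees_def, rule_format, OF h] by blast
      have GX: "G \<subseteq> ?X" using G(1) maker_claims_subset[OF h(1)] by simp
      have n0: "0 < n" using n40 by simp
      have dense: "(D + 1)\<^sup>2 * n \<le> D\<^sup>2 * card G" using edges G(2) by simp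
      obtain vs where vs: "is_cycle G vs" "m \<le> 8 * D * length vs"
        using long_cycle_of_sparse[OF D n0 GX dense G(3) mD] by blast
      have "c * real n = (\<alpha> * real n) / (16 * D)" by (simp add: c_def)
      also have "\<dots> \<le> (2 * real m) / (16 * D)"
        using m n\<alpha> by (intro divide_right_mono) auto
      also have "\<dots> \<le> real (length vs)"
      proof -
        have "real m \<le> real (8 * D * length vs)" using vs(2) by (rule of_nat_mono)
        then show ?thesis using D by (simp add: field_simps)
      qed
      finally show "\<exists>vs. is_cycle (maker_claims h) vs \<and> real (length vs) \<ge> c * real n"
        using is_cycle_mono[OF vs(1) G(1)] by blast
    qed
    then show ?thesis using s by blast
  qed
  moreover have "c > 0" using \<alpha> D by (simp add: c_def)
  ultimately show ?thesis by blast
qed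

end
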